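(* Let $\alpha\ge 1$ be a computable ordinal. There is no countable $\boldsymbol{\Sigma}^0_\alpha$ colouring of the directed graph $K_\alpha$ on $\mathbb{X}_\alpha$.
   Context: The tree. The computable ordinal $\alpha$ is identified with a computable well-ordering of a computable subset of $\mathbb{N}$ whose successor relation and set of limit points are computable; this gives, uniformly for each limit $\delta\le\alpha$, a computable increasing sequence $(\delta_k)$ cofinal in $\delta$. $T_\alpha\subset \mathbb{N}^{<\omega}$ is the computable well-founded tree, with computable rank function $\mathrm{rk}$, defined as follows: the root $\langle\rangle$ is in $T_\alpha$ and has rank $\alpha$; if $\sigma\in T_\alpha$ has limit rank $\delta$ then for all $k$, $\sigma^\frown k\in T_\alpha$ and has rank $\delta_k$; if $\sigma\in T_\alpha$ has rank $\beta+1$ then for all $k$, $\sigma^\frown k\in T_\alpha$ and has rank $\beta$; nodes of rank $0$ are leaves. $\mathcal{L}_\alpha$ is the set of leaves. $2^{\mathcal{L}_\alpha}$ carries the product topology. Labelling. For $x\in 2^{\mathcal{L}_\alpha}$, $T^x\colon T_\alpha\to\{0,1\}$ is defined by recursion: $T^x(\sigma)=x(\sigma)$ for leaves $\sigma$; for $\sigma$ not a leaf, $T^x(\sigma)=0$ if and only if there is some $k$ with $T^x(\sigma^\frown k)=1$. The graph. $\mathbb{X}_\alpha=2^{\mathcal{L}_\alpha}\times \mathcal{P}(\mathbb{N})$, where $\mathcal{P}(\mathbb{N})$ is identified with Cantor space. The directed graph $K_\alpha$ on $\mathbb{X}_\alpha$: there is an edge from $(x,y)$ to $(x',y')$ if $x'=x$,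 $T^x(\langle\rangle)=0$, and for the least $n$ such that $T^x(\langle n\rangle)=1$ we have $y\bigtriangleup y'=\{n\}$ and $n\notin y$. A countable $\boldsymbol{\Sigma}^0_\alpha$ colouring of a directed graph is a partition of the space into countably many $\boldsymbol{\Sigma}^0_\alpha$ sets, none of which contains both endpoints of an edge. *)

theory Defs
  imports "HOL-Analysis.Analysis" "HOL-Library.Disjoint_Sets"
begin

section \<open>Computability\<close>

text \<open>\<open>general_recursive n F\<close>: on argument lists of length \<open>n\<close>, \<open>F\<close> is a total general recursive
  function of arity \<open>n\<close>; minimisation is only applied to regular functions. The values of \<open>F\<close> on
  lists of other lengths carry no meaning.\<close>

inductive general_recursive :: "nat \<Rightarrow> (nat list \<Rightarrow> nat) \<Rightarrow> bool" where
  zero: "general_recursive n (\<lambda>xs. 0)"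
| succ: "general_recursive 1 (\<lambda>xs. Suc (xs ! 0))"
| proj: "i < n \<Longrightarrow> general_recursive n (\<lambda>xs. xs ! i)"
| comp: "general_recursive (length Gs) F \<Longrightarrow> \<forall>G\<in>set Gs. general_recursive n G
    \<Longrightarrow> general_recursive n (\<lambda>xs. F (map (\<lambda>G. G xs) Gs))"
| prim_rec: "general_recursive n F \<Longrightarrow> general_recursive (Suc (Suc n)) G
    \<Longrightarrow> general_recursive (Suc n)
          (\<lambda>xs. rec_nat (F (tl xs)) (\<lambda>k v. G (k # v # tl xs)) (hd xs))"
| minim: "general_recursive (Suc n) F \<Longrightarrow> \<forall>xs. length xs = n \<longrightarrow> (\<exists>k. F (k # xs) = 0)
    \<Longrightarrow> general_recursive n (\<lambda>xs. LEAST k. F (k # xs) = 0)"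

definition computable1 :: "(nat \<Rightarrow> nat) \<Rightarrow> bool" where
  "computable1 f \<longleftrightarrow> (\<exists>F. general_recursive 1 F \<and> (\<forall>a. F [a] = f a))"

definition computable2 :: "(nat \<Rightarrow> nat \<Rightarrow> nat) \<Rightarrow> bool" where
  "computable2 f \<longleftrightarrow> (\<exists>F. general_recursive 2 F \<and> (\<forall>a b. F [a, b] = f a b))"

definition computable_set :: "nat set \<Rightarrow> bool" where
  "computable_set A \<longleftrightarrow> computable1 (\<lambda>a. of_bool (a \<in> A))"

definition computable_rel :: "nat rel \<Rightarrow> bool" where
  "computable_rel R \<longleftrightarrow> computable2 (\<lambda>a b. of_bool ((a, b) \<in> R))"


section \<open>Computable ordinals\<close>

text \<open>An ordinal \<open>\<alpha>\<close> is a (reflexive) well-order \<open>r\<close> on its field, a set of natural numbers. The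
  ordinals \<open>\<le> \<alpha>\<close> are represented by \<^typ>\<open>nat option\<close>: \<open>Some b\<close> with \<open>b \<in> Field r\<close> stands for the
  order type of the elements strictly below \<open>b\<close>, and \<^const>\<open>None\<close> stands for \<open>\<alpha>\<close> itself.\<close>

definition below :: "nat rel \<Rightarrow> nat option \<Rightarrow> nat set" where
  "below r \<rho> = (case \<rho> of None \<Rightarrow> Field r | Some b \<Rightarrow> underS r b)"

text \<open>\<open>is_pred r \<beta> \<rho>\<close>: \<open>\<rho> = \<beta> + 1\<close>.\<close>

definition is_pred :: "nat rel \<Rightarrow> nat \<Rightarrow> nat option \<Rightarrow> bool" where
  "is_pred r \<beta> \<rho> \<longleftrightarrow> \<beta> \<in> below r \<rho> \<and> (\<forall>\<gamma>\<in>below r \<rho>. (\<gamma>, \<beta>) \<in> r)"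

definition is_limit :: "nat rel \<Rightarrow> nat option \<Rightarrow> bool" where
  "is_limit r \<rho> \<longleftrightarrow>
     below r \<rho> \<noteq> {} \<and> (\<forall>\<beta>\<in>below r \<rho>. \<exists>\<gamma>\<in>below r \<rho>. (\<beta>, \<gamma>) \<in> r \<and> \<beta> \<noteq> \<gamma>)"

definition computable_ordinal :: "nat rel \<Rightarrow> bool" where
  "computable_ordinal r \<longleftrightarrow>
     Well_order r \<and> computable_set (Field r) \<and> computable_rel r \<and>
     computable_rel {(\<beta>, \<gamma>). \<gamma> \<in> Field r \<and> is_pred r \<beta> (Some \<gamma>)} \<and>
     computable_set {\<delta> \<in> Field r. is_limit r (Some \<delta>)}"

text \<open>\<open>fs \<delta>\<close> is the sequence \<open>(\<delta>\<^sub>k)\<close> chosen for the limit ordinal \<open>\<delta> \<le> \<alpha>\<close>. Its values at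
  non-limits play no role.\<close>

definition fundamental_sequences :: "nat rel \<Rightarrow> (nat option \<Rightarrow> nat \<Rightarrow> nat) \<Rightarrow> bool" where
  "fundamental_sequences r fs \<longleftrightarrow>
     (\<exists>f. computable2 f \<and>
        (\<forall>\<delta>\<in>Field r. is_limit r (Some \<delta>) \<longrightarrow> (\<forall>k. fs (Some \<delta>) k = f \<delta> k))) \<and>
     (is_limit r None \<longrightarrow> computable1 (fs None)) \<and>
     (\<forall>\<rho> \<in> insert None (Some ` Field r). is_limit r \<rho> \<longrightarrow>
        (\<forall>k. fs \<rho> k \<in> below r \<rho>) \<and>
        (\<forall>k. (fs \<rho> k, fs \<rho> (Suc k)) \<in> r \<and> fs \<rho> k \<noteq> fs \<rho> (Suc k)) \<and>
        (\<forall>\<beta>\<in>below r \<rho>. \<exists>k. (\<beta>, fs \<rho> k) \<in> r))"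


section \<open>The tree and its labellings\<close>

text \<open>\<open>node_rank r fs \<sigma> \<rho>\<close>: \<open>\<sigma> \<in> T\<^sub>\<alpha>\<close> and \<open>rk \<sigma> = \<rho>\<close>.\<close>

inductive node_rank :: "nat rel \<Rightarrow> (nat option \<Rightarrow> nat \<Rightarrow> nat) \<Rightarrow> nat list \<Rightarrow> nat option \<Rightarrow> bool"
  for r fs where
  root: "node_rank r fs [] None"
| limit: "node_rank r fs \<sigma> \<delta> \<Longrightarrow> is_limit r \<delta> \<Longrightarrow> node_rank r fs (\<sigma> @ [k]) (Some (fs \<delta> k))"
| succ: "node_rank r fs \<sigma> \<rho> \<Longrightarrow> is_pred r \<beta> \<rho> \<Longrightarrow> node_rank r fs (\<sigma> @ [k]) (Some \<beta>)"

definition tree :: "nat rel \<Rightarrow> (nat option \<Rightarrow> nat \<Rightarrow> nat) \<Rightarrow> nat list set" where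
  "tree r fs = {\<sigma>. \<exists>\<rho>. node_rank r fs \<sigma> \<rho>}"

definition leaves :: "nat rel \<Rightarrow> (nat option \<Rightarrow> nat \<Rightarrow> nat) \<Rightarrow> nat list set" where
  "leaves r fs = {\<sigma> \<in> tree r fs. \<forall>k. \<sigma> @ [k] \<notin> tree r fs}"

definition child_rel :: "nat rel \<Rightarrow> (nat option \<Rightarrow> nat \<Rightarrow> nat) \<Rightarrow> nat list rel" where
  "child_rel r fs = {(\<sigma> @ [k], \<sigma>) |\<sigma> k. \<sigma> @ [k] \<in> tree r fs}"

text \<open>The labels \<open>0\<close> and \<open>1\<close> are \<^const>\<open>False\<close> and \<^const>\<open>True\<close>. The recursion is justified, and its
  equations derived, in \<open>wf_child_rel\<close>, \<open>labelling_leaf\<close> and \<open>labelling_inner\<close> below.\<close>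

definition labelling ::
    "nat rel \<Rightarrow> (nat option \<Rightarrow> nat \<Rightarrow> nat) \<Rightarrow> (nat list \<Rightarrow> bool) \<Rightarrow> nat list \<Rightarrow> bool" where
  "labelling r fs x = wfrec (child_rel r fs)
     (\<lambda>T \<sigma>. if \<sigma> \<in> leaves r fs then x \<sigma> else \<not> (\<exists>k. T (\<sigma> @ [k])))"

lemma node_rank_range:
  assumes "fundamental_sequences r fs" "node_rank r fs \<sigma> \<rho>"
  shows "\<rho> \<in> insert None (Some ` Field r)"
  using assms(2)
proof (induction rule: node_rank.induct)
  case (limit \<sigma> \<delta> k)
  then have "fs \<delta> k \<in> below r \<delta>"
    using assms(1) unfolding fundamental_sequences_def by blast
  then show ?case
    by (auto simp: below_def underS_def Field_def split: option.splits)
next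
  case (succ \<sigma> \<rho> \<beta> k)
  then show ?case
    by (auto simp: is_pred_def below_def underS_def Field_def split: option.splits)
qed simp

lemma pred_not_limit:
  assumes "Well_order r" "is_pred r \<beta> \<rho>"
  shows "\<not> is_limit r \<rho>"
proof
  assume "is_limit r \<rho>"
  then obtain \<gamma> where "\<gamma> \<in> below r \<rho>" "(\<beta>, \<gamma>) \<in> r" "\<beta> \<noteq> \<gamma>"
    using assms(2) unfolding is_limit_def is_pred_def by blast
  moreover from this have "(\<gamma>, \<beta>) \<in> r"
    using assms(2) unfolding is_pred_def by blast
  ultimately show False
    using assms(1) unfolding order_on_defs antisym_def by blast
qed

lemma pred_unique:
  assumes "Well_order r" "is_pred r \<beta> \<rho>" "is_pred r \<gamma> \<rho>"
  shows "\<beta> = \<gamma>"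
  using assms unfolding is_pred_def order_on_defs antisym_def by blast

lemma node_rank_unique:
  assumes "Well_order r" "node_rank r fs \<sigma> \<rho>" "node_rank r fs \<sigma> \<rho>'"
  shows "\<rho> = \<rho>'"
  using assms(2,3)
proof (induction arbitrary: \<rho>' rule: node_rank.induct)
  case root
  then show ?case by (cases rule: node_rank.cases) auto
next
  case (limit \<sigma> \<delta> k)
  from limit.prems show ?case
  proof (cases rule: node_rank.cases)
    case (limit \<sigma>' \<delta>' k')
    then show ?thesis using limit.IH[of \<delta>'] by simp
  next
    case (succ \<sigma>' \<rho>'' \<beta> k')
    then have "\<delta> = \<rho>''" using limit.IH[of \<rho>''] by simp
    then show ?thesis using succ limit.hyps(2) pred_not_limit[OF assms(1)] by blast
  qed simp
next
  case (succ \<sigma> \<rho> \<beta> k)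
  from succ.prems show ?case
  proof (cases rule: node_rank.cases)
    case (limit \<sigma>' \<delta>' k')
    then have "\<rho> = \<delta>'" using succ.IH[of \<delta>'] by simp
    then show ?thesis using limit succ.hyps(2) pred_not_limit[OF assms(1)] by blast
  next
    case (succ \<sigma>' \<rho>'' \<gamma> k')
    then have "\<rho> = \<rho>''" using succ.IH[of \<rho>''] by simp
    then show ?thesis using succ succ.hyps(2) pred_unique[OF assms(1)] by blast
  qed simp
qed

lemma rank_cases:
  assumes "Well_order r" "below r \<rho> \<noteq> {}"
  shows "is_limit r \<rho> \<or> (\<exists>\<beta>. is_pred r \<beta> \<rho>)"
proof (cases "is_limit r \<rho>")
  case False
  then obtain \<beta> where b: "\<beta> \<in> below r \<rho>" "\<forall>\<gamma>\<in>below r \<rho>. (\<beta>, \<gamma>) \<in> r \<longrightarrow> \<beta> = \<gamma>"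
    using assms(2) unfolding is_limit_def by blast
  have f: "below r \<rho> \<subseteq> Field r"
    by (auto simp: below_def underS_def Field_def split: option.splits)
  have "(\<gamma>, \<beta>) \<in> r" if "\<gamma> \<in> below r \<rho>" for \<gamma>
    using b that f assms(1) unfolding order_on_defs refl_on_def total_on_def by (metis subsetD)
  then show ?thesis
    using b(1) unfolding is_pred_def by blast
qed simp

lemma child_rank_below:
  assumes "Well_order r" "fundamental_sequences r fs"
    "node_rank r fs \<sigma> \<rho>" "node_rank r fs (\<sigma> @ [k]) \<rho>'"
  shows "\<exists>\<beta>\<in>below r \<rho>. \<rho>' = Some \<beta>"
  using assms(4)
proof (cases rule: node_rank.cases)
  case (limit \<sigma>' \<delta> k')
  then have "\<delta> = \<rho>" using node_rank_unique[OF assms(1)] assms(3) by auto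
  then show ?thesis
    using limit node_rank_range[OF assms(2,3)] assms(2)
    unfolding fundamental_sequences_def by blast
next
  case (succ \<sigma>' \<rho>'' \<beta> k')
  then have "\<rho>'' = \<rho>" using node_rank_unique[OF assms(1)] assms(3) by auto
  then show ?thesis using succ by (auto simp: is_pred_def)
qed auto

lemma leaves_iff_rank_0:
  assumes "Well_order r" "fundamental_sequences r fs" "node_rank r fs \<sigma> \<rho>"
  shows "\<sigma> \<in> leaves r fs \<longleftrightarrow> below r \<rho> = {}"
proof
  assume l: "\<sigma> \<in> leaves r fs"
  show "below r \<rho> = {}"
  proof (rule ccontr)
    assume "below r \<rho> \<noteq> {}"
    then have "\<sigma> @ [0] \<in> tree r fs"
      using rank_cases[OF assms(1)] assms(3) node_rank.limit node_rank.succ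
      unfolding tree_def by blast
    then show False using l unfolding leaves_def by blast
  qed
next
  assume "below r \<rho> = {}"
  then show "\<sigma> \<in> leaves r fs"
    using child_rank_below[OF assms(1,2,3)] assms(3) unfolding leaves_def tree_def by blast
qed

lemma tree_prefix: "\<sigma> @ [k] \<in> tree r fs \<Longrightarrow> \<sigma> \<in> tree r fs"
  unfolding tree_def by (auto elim: node_rank.cases)

lemma wf_child_rel:
  assumes "Well_order r" "fundamental_sequences r fs"
  shows "wf (child_rel r fs)"
proof -
  have w: "wf (r - Id)"
    using assms(1) by (simp add: well_order_on_def)
  have step: "\<beta> \<in> Wellfounded.acc (child_rel r fs)"
    if "node_rank r fs \<beta> (Some b)" for b \<beta>
    using w that
  proof (induction b arbitrary: \<beta> rule: wf_induct_rule)
    case (less b)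
    show ?case
    proof (rule accI)
      fix \<tau> assume "(\<tau>, \<beta>) \<in> child_rel r fs"
      then obtain k \<rho>' where \<tau>: "\<tau> = \<beta> @ [k]" "node_rank r fs \<tau> \<rho>'"
        unfolding child_rel_def tree_def by auto
      then obtain c where "c \<in> below r (Some b)" "\<rho>' = Some c"
        using child_rank_below[OF assms less.prems] by blast
      then show "\<tau> \<in> Wellfounded.acc (child_rel r fs)"
        using less.IH \<tau> by (auto simp: below_def underS_def)
    qed
  qed
  have "\<sigma> \<in> Wellfounded.acc (child_rel r fs)" for \<sigma>
  proof (rule accI)
    fix \<tau> assume "(\<tau>, \<sigma>) \<in> child_rel r fs"
    then obtain k \<rho> \<rho>' where "\<tau> = \<sigma> @ [k]" "node_rank r fs \<tau> \<rho>'" "node_rank r fs \<sigma> \<rho>"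
      using tree_prefix unfolding child_rel_def tree_def by blast
    then show "\<tau> \<in> Wellfounded.acc (child_rel r fs)"
      using child_rank_below[OF assms] step by blast
  qed
  then show ?thesis by (simp add: wf_iff_acc)
qed

lemma labelling_leaf:
  assumes "Well_order r" "fundamental_sequences r fs" "\<sigma> \<in> leaves r fs"
  shows "labelling r fs x \<sigma> = x \<sigma>"
  unfolding labelling_def by (subst wfrec[OF wf_child_rel]) (use assms in auto)

lemma labelling_inner:
  assumes "Well_order r" "fundamental_sequences r fs" "\<sigma> \<in> tree r fs" "\<sigma> \<notin> leaves r fs"
  shows "\<not> labelling r fs x \<sigma> \<longleftrightarrow> (\<exists>k. labelling r fs x (\<sigma> @ [k]))"
proof -
  obtain \<rho> where \<rho>: "node_rank r fs \<sigma> \<rho>" using assms(3) unfolding tree_def by blast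
  then have "\<sigma> @ [k] \<in> tree r fs" for k
    using rank_cases[OF assms(1)] leaves_iff_rank_0[OF assms(1,2) \<rho>] assms(4)
      node_rank.limit node_rank.succ unfolding tree_def by blast
  then have c: "(\<sigma> @ [k], \<sigma>) \<in> child_rel r fs" for k
    unfolding child_rel_def by blast
  show ?thesis
    unfolding labelling_def
    by (subst wfrec[OF wf_child_rel[OF assms(1,2)]]) (use assms(4) c in \<open>simp add: cut_apply\<close>)
qed


section \<open>The space and the directed graph\<close>

definition powerset_topology :: "nat set topology" where
  "powerset_topology =
     pullback_topology UNIV (\<lambda>y n. n \<in> y)
       (product_topology (\<lambda>n. discrete_topology (UNIV :: bool set)) UNIV)"

definition X_space ::
    "nat rel \<Rightarrow> (nat option \<Rightarrow> nat \<Rightarrow> nat) \<Rightarrow> ((nat list \<Rightarrow> bool) \<times> nat set) topology" where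
  "X_space r fs =
     prod_topology
       (product_topology (\<lambda>\<sigma>. discrete_topology (UNIV :: bool set)) (leaves r fs))
       powerset_topology"

definition K_graph ::
    "nat rel \<Rightarrow> (nat option \<Rightarrow> nat \<Rightarrow> nat) \<Rightarrow> ((nat list \<Rightarrow> bool) \<times> nat set) rel" where
  "K_graph r fs =
     {((x, y), (x', y')). (x, y) \<in> topspace (X_space r fs) \<and> (x', y') \<in> topspace (X_space r fs) \<and>
        x' = x \<and> \<not> labelling r fs x [] \<and>
        (let n = (LEAST n. labelling r fs x [n]) in sym_diff y y' = {n} \<and> n \<notin> y)}"


section \<open>The Borel hierarchy and colourings\<close>

text \<open>\<open>Sigma0 X r A\<close>: \<open>A\<close> is a boldface \<open>\<Sigma>\<^sup>0\<^sub>\<alpha>\<close> subset of \<open>X\<close>, where \<open>\<alpha> \<ge> 1\<close> is the order type of \<open>r\<close>: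
  \<open>\<Sigma>\<^sup>0\<^sub>1\<close> consists of the open sets, and for \<open>\<alpha> > 1\<close>, \<open>\<Sigma>\<^sup>0\<^sub>\<alpha>\<close> consists of the countable unions of sets
  whose complements are \<open>\<Sigma>\<^sup>0\<^sub>\<beta>\<close> for some \<open>1 \<le> \<beta> < \<alpha>\<close> (a different \<open>\<beta>\<close> is allowed for each set).
  Well-orders of sets of natural numbers represent all countable ordinals.\<close>

inductive Sigma0 :: "'a topology \<Rightarrow> nat rel \<Rightarrow> 'a set \<Rightarrow> bool" for X where
  open_set: "Well_order r \<Longrightarrow> card (Field r) = 1 \<Longrightarrow> openin X U \<Longrightarrow> Sigma0 X r U"
| union: "\<forall>n::nat. (s n, r) \<in> ordLess \<and> Field (s n) \<noteq> {} \<and> Sigma0 X (s n) (B n)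
    \<Longrightarrow> Sigma0 X r (\<Union>n. topspace X - B n)"

definition countable_Sigma0_colouring ::
    "nat rel \<Rightarrow> 'a topology \<Rightarrow> 'a rel \<Rightarrow> 'a set set \<Rightarrow> bool" where
  "countable_Sigma0_colouring r X K P \<longleftrightarrow>
     countable P \<and> partition_on (topspace X) P \<and>
     (\<forall>A\<in>P. Sigma0 X r A \<and> \<not> (\<exists>(p, q)\<in>K. p \<in> A \<and> q \<in> A))"

end

theory Submission
  imports Defs
begin

text \<open>
  The idea is a forcing argument in the style of Steel forcing. A condition is a finite consistent set of
  requirements on \<open>(x, y)\<close>: certain nodes have label \<open>1\<close>, certain leaves have label \<open>0\<close>, certain
  numbers are in or out of \<open>y\<close>. Truncating a condition at an ordinal \<open>\<beta>\<close> forgets the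
  requirements ``label \<open>1\<close>'' at nodes of rank above \<open>\<beta>\<close>. If a condition \<open>p\<close> forces membership in a
  \<open>\<Pi>\<^sup>0\<^sub>\<beta>\<close> set, then, after extending \<open>p\<close> suitably, already its truncation at \<open>\<beta>\<close> does.

  Given a countable \<open>\<Sigma>\<^sup>0\<^sub>\<alpha>\<close> colouring, force with the root labelled \<open>1\<close>. Some extension \<open>p\<close> forces
  membership in a \<open>\<Pi>\<^sup>0\<^sub>\<beta>\<close> subset of a single colour \<open>A\<close>, with \<open>\<beta> < \<alpha>\<close>, hence so does its truncation,
  which says nothing about the root any more. Now label a fresh child \<open>\<langle>n\<rangle>\<close> with \<open>1\<close> and the children
  \<open>\<langle>m\<rangle>\<close>, \<open>m < n\<close>, with \<open>0\<close>. Since \<open>n\<close> is fresh, a generic \<open>(x, y)\<close> and \<open>(x, y \<union> {n})\<close> are both in \<open>A\<close>,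
  and they form an edge.
\<close>

unbundle cardinal_syntax

section \<open>Open sets in products of discrete spaces, and the empty well-order\<close>

lemma openin_product_discrete:
  assumes "openin (product_topology (\<lambda>i. discrete_topology (UNIV :: 'b set)) I) U" "x \<in> U"
  shows "\<exists>F\<subseteq>I. finite F \<and> (\<forall>x'\<in>extensional I. (\<forall>i\<in>F. x' i = x i) \<longrightarrow> x' \<in> U)"
proof -
  obtain V where V: "finite {i \<in> I. V i \<noteq> UNIV}" "x \<in> Pi\<^sub>E I V" "Pi\<^sub>E I V \<subseteq> U"
    using assms unfolding openin_product_topology_alt by force
  have "x' \<in> U" if "x' \<in> extensional I" "\<forall>i\<in>{i \<in> I. V i \<noteq> UNIV}. x' i = x i" for x'
  proof -
    have "x' i \<in> V i" if "i \<in> I" for i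
      using \<open>\<forall>i\<in>_. _\<close> V(2) that by (cases "V i = UNIV") (auto simp: PiE_iff)
    then have "x' \<in> Pi\<^sub>E I V" using that(1) by (simp add: PiE_iff)
    then show ?thesis using V(3) by blast
  qed
  then show ?thesis using V(1) by (intro exI[of _ "{i \<in> I. V i \<noteq> UNIV}"]) auto
qed

lemma empty_ordLeq:
  assumes "Well_order s"
  shows "({} :: 'a rel) \<le>o s"
  unfolding ordLeq_def using assms by (auto simp: embed_def)

lemma empty_ordLess:
  assumes "Well_order s" "Field s \<noteq> {}"
  shows "({} :: 'a rel) <o s"
proof -
  have "\<not> s \<le>o ({} :: 'a rel)"
    using assms embed_Field unfolding ordLeq_def by fastforce
  moreover have "Well_order ({} :: 'a rel)"
    by (simp add: order_on_defs refl_on_def total_on_def trans_def antisym_def)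
  ultimately show ?thesis using not_ordLeq_iff_ordLess assms(1) by blast
qed

text \<open>\<open>Zero\<close> is meant for leaves only: at an inner node, label 0 amounts to label
  1 at some child, so it is expressed by \<open>One\<close> at that child.\<close>

datatype lit = One "nat list" | Zero "nat list" | In nat | Out nat

instance lit :: countable by countable_datatype

section \<open>Ranks of nodes\<close>

locale ranked_tree =
  fixes r :: "nat rel" and fs :: "nat option \<Rightarrow> nat \<Rightarrow> nat"
  assumes wo: "Well_order r" and field_nonempty: "Field r \<noteq> {}"
    and fund: "fundamental_sequences r fs"
begin

abbreviation "T \<equiv> tree r fs"
abbreviation "L \<equiv> leaves r fs"
abbreviation "X \<equiv> X_space r fs"
abbreviation "lab \<equiv> labelling r fs"

text \<open>Ranks are kept as well-orders, so that \<open><o\<close> and \<open>\<le>o\<close>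
  compare them with one another and with the orders indexing \<open>Sigma0\<close>, which may have
  unrelated fields.\<close>

definition rk :: "nat list \<Rightarrow> nat rel" where
  "rk \<sigma> = Restr r (below r (THE \<rho>. node_rank r fs \<sigma> \<rho>))"

lemma rk_eq:
  assumes "node_rank r fs \<sigma> \<rho>"
  shows "rk \<sigma> = Restr r (below r \<rho>)"
proof -
  have "(THE \<rho>. node_rank r fs \<sigma> \<rho>) = \<rho>"
    using assms node_rank_unique[OF wo] by blast
  then show ?thesis by (simp add: rk_def)
qed

lemma Well_order_rk: "Well_order (rk \<sigma>)"
  unfolding rk_def by (rule Well_order_Restr[OF wo])

lemma root_in_tree: "[] \<in> T"
  unfolding tree_def using node_rank.root by blast

lemma rk_root: "rk [] = r"
  using rk_eq[OF node_rank.root] by (auto simp: below_def Field_def)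

lemma ofilter_below: "wo_rel.ofilter r (below r \<rho>)"
  using wo by (auto simp: below_def wo_rel_def wo_rel.underS_ofilter wo_rel.Field_ofilter
    split: option.splits)

lemma Field_Restr_below: "Field (Restr r (below r \<rho>)) = below r \<rho>"
  by (rule Field_Restr_ofilter[OF wo ofilter_below])

lemma leaf_iff_rk:
  assumes "\<sigma> \<in> T"
  shows "\<sigma> \<in> L \<longleftrightarrow> rk \<sigma> = {}"
proof -
  obtain \<rho> where \<rho>: "node_rank r fs \<sigma> \<rho>" using assms unfolding tree_def by blast
  have "rk \<sigma> = {} \<longleftrightarrow> below r \<rho> = {}"
    using Field_Restr_below[of \<rho>] rk_eq[OF \<rho>] by (metis Field_empty Int_empty_right Sigma_empty1)
  then show ?thesis using leaves_iff_rank_0[OF wo fund \<rho>] by simp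
qed

lemma rk_child:
  assumes "\<sigma> @ [k] \<in> T"
  shows "rk (\<sigma> @ [k]) <o rk \<sigma>"
proof -
  obtain \<rho> \<rho>' where \<rho>: "node_rank r fs \<sigma> \<rho>" "node_rank r fs (\<sigma> @ [k]) \<rho>'"
    using assms tree_prefix[OF assms] unfolding tree_def by blast
  obtain b where b: "b \<in> below r \<rho>" "\<rho>' = Some b"
    using child_rank_below[OF wo fund \<rho>] by blast
  have "below r (Some b) \<subset> below r \<rho>"
  proof
    have "under r b \<subseteq> below r \<rho>"
      using ofilter_below b(1) wo by (simp add: wo_rel_def wo_rel.ofilter_def)
    then show "below r (Some b) \<subseteq> below r \<rho>"
      by (auto simp: below_def underS_def under_def)
    show "below r (Some b) \<noteq> below r \<rho>"
      using b(1) by (auto simp: below_def underS_def)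
  qed
  then show ?thesis
    using rk_eq[OF \<rho>(1)] rk_eq[OF \<rho>(2)] b(2) ofilter_subset_ordLess[OF wo ofilter_below ofilter_below]
    by simp
qed

lemma below_mono: "(a, b) \<in> r \<Longrightarrow> below r (Some a) \<subseteq> below r (Some b)"
  using wo unfolding below_def by (simp add: underS_incr order_on_defs)

lemma children_in_tree:
  assumes "\<sigma> \<in> T" "\<sigma> \<notin> L"
  shows "\<sigma> @ [k] \<in> T"
proof -
  obtain \<rho> where \<rho>: "node_rank r fs \<sigma> \<rho>" using assms(1) unfolding tree_def by blast
  show ?thesis
    using rank_cases[OF wo] leaves_iff_rank_0[OF wo fund \<rho>] assms(2)
      node_rank.limit[OF \<rho>] node_rank.succ[OF \<rho>] unfolding tree_def by blast
qed

text \<open>At a successor node all children have the predecessor rank; at a limit node the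
  increasing cofinal fundamental sequence eventually passes the point cutting out \<open>s\<close>.
  So only finitely many children have rank below \<open>s\<close>, which lets finite conditions be
  made \<open>good\<close>.\<close>

lemma eventually_rk_child:
  assumes "\<sigma> \<in> T" "s <o rk \<sigma>"
  shows "\<exists>N. \<forall>k\<ge>N. s \<le>o rk (\<sigma> @ [k])"
proof -
  obtain \<rho> where \<rho>: "node_rank r fs \<sigma> \<rho>" using assms(1) unfolding tree_def by blast
  have ws: "Well_order s" using assms(2) unfolding ordLess_def by auto
  \<comment> \<open>\<open>a\<close> is the point of the rank of \<open>\<sigma>\<close> whose
    initial segment has order type \<open>s\<close>.\<close>
  obtain a where a: "a \<in> Field (rk \<sigma>)" "s =o Restr (rk \<sigma>) (underS (rk \<sigma>) a)"
    using ordLess_iff_ordIso_Restr[OF Well_order_rk ws] assms(2) by blast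
  have ab: "a \<in> below r \<rho>" using a(1) Field_Restr_below rk_eq[OF \<rho>] by simp
  have "underS (rk \<sigma>) a = below r (Some a)"
  proof -
    have "under r a \<subseteq> below r \<rho>"
      using ofilter_below ab wo by (simp add: wo_rel_def wo_rel.ofilter_def)
    then show ?thesis using ab unfolding rk_eq[OF \<rho>]
      by (auto simp: below_def underS_def under_def)
  qed
  moreover have "underS (rk \<sigma>) a \<subseteq> below r \<rho>"
    unfolding rk_eq[OF \<rho>] by (auto simp: underS_def)
  ultimately have "Restr (rk \<sigma>) (underS (rk \<sigma>) a) = Restr r (below r (Some a))"
    unfolding rk_eq[OF \<rho>] by blast
  then have sa: "s =o Restr r (below r (Some a))" using a(2) by simp
  have le: "s \<le>o rk (\<sigma> @ [k])" if "node_rank r fs (\<sigma> @ [k]) (Some c)" "(a, c) \<in> r" for k c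
    using ordIso_ordLeq_trans[OF sa] ofilter_subset_ordLeq[OF wo ofilter_below ofilter_below]
      below_mono[OF that(2)] rk_eq[OF that(1)] by simp
  from rank_cases[OF wo] ab consider "is_limit r \<rho>" | b where "is_pred r b \<rho>" by blast
  then show ?thesis
  proof cases
    case 1
    have R: "\<rho> \<in> insert None (Some ` Field r)" by (rule node_rank_range[OF fund \<rho>])
    have inc: "(fs \<rho> k, fs \<rho> (Suc k)) \<in> r" for k
      using fund 1 R unfolding fundamental_sequences_def by blast
    obtain N where N: "(a, fs \<rho> N) \<in> r"
      using fund 1 R ab unfolding fundamental_sequences_def by blast
    have tr: "trans r" using wo by (simp add: order_on_defs)
    have "(a, fs \<rho> k) \<in> r" if "k \<ge> N" for k
      using that
    proof (induction k rule: dec_induct)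
      case (step k)
      then show ?case using inc[of k] tr by (meson transD)
    qed (rule N)
    then show ?thesis using le node_rank.limit[OF \<rho> 1] by blast
  next
    case 2
    then have "(a, b) \<in> r" using ab unfolding is_pred_def by blast
    then show ?thesis using le node_rank.succ[OF \<rho> 2] by blast
  qed
qed

section \<open>Label equations and basic neighbourhoods\<close>

lemma lab_leaf: "\<sigma> \<in> L \<Longrightarrow> lab x \<sigma> = x \<sigma>"
  by (rule labelling_leaf[OF wo fund])

lemma lab_inner: "\<sigma> \<in> T \<Longrightarrow> \<sigma> \<notin> L \<Longrightarrow> \<not> lab x \<sigma> \<longleftrightarrow> (\<exists>k. lab x (\<sigma> @ [k]))"
  by (rule labelling_inner[OF wo fund])

lemma topspace_X: "(x, y) \<in> topspace X \<longleftrightarrow> x \<in> extensional L"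
  by (simp add: X_space_def powerset_topology_def topspace_pullback_topology PiE_def)

lemma openin_X_nbhd:
  assumes "openin X A" "(x, y) \<in> A"
  shows "\<exists>F\<subseteq>L. \<exists>G. finite F \<and> finite G \<and>
    (\<forall>x' y'. (x', y') \<in> topspace X \<longrightarrow> (\<forall>\<sigma>\<in>F. x' \<sigma> = x \<sigma>) \<longrightarrow> (\<forall>n\<in>G. n \<in> y' \<longleftrightarrow> n \<in> y) \<longrightarrow> (x', y') \<in> A)"
proof -
  obtain U V where UV: "openin (product_topology (\<lambda>\<sigma>. discrete_topology (UNIV :: bool set)) L) U"
      "openin powerset_topology V" "x \<in> U" "y \<in> V" "U \<times> V \<subseteq> A"
    using assms(1)[unfolded X_space_def openin_prod_topology_alt, rule_format, OF assms(2)] by metis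
  obtain W where W: "openin (product_topology (\<lambda>n. discrete_topology (UNIV :: bool set)) (UNIV :: nat set)) W"
      "V = (\<lambda>y n. n \<in> y) -` W \<inter> UNIV"
    using UV(2) unfolding powerset_topology_def openin_pullback_topology by blast
  obtain F where F: "F \<subseteq> L" "finite F" "\<forall>x'\<in>extensional L. (\<forall>i\<in>F. x' i = x i) \<longrightarrow> x' \<in> U"
    using openin_product_discrete[OF UV(1,3)] by blast
  have "(\<lambda>n. n \<in> y) \<in> W" using UV(4) W(2) by simp
  from openin_product_discrete[OF W(1) this]
  obtain G where G: "finite G" "\<forall>w. (\<forall>i\<in>G. w i = (i \<in> y)) \<longrightarrow> w \<in> W" by auto
  have "(x', y') \<in> A" if "(x', y') \<in> topspace X" "\<forall>\<sigma>\<in>F. x' \<sigma> = x \<sigma>" "\<forall>n\<in>G. n \<in> y' \<longleftrightarrow> n \<in> y" for x' y'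
  proof -
    have "x' \<in> U" using F(3) that(1,2) topspace_X by blast
    moreover have "y' \<in> V" using G(2) that(3) W(2) by simp
    ultimately show ?thesis using UV(5) by blast
  qed
  then show ?thesis using F(1,2) G(1) by blast
qed


section \<open>Conditions\<close>

text \<open>Consistency is syntactic, yet sufficient: by \<open>generic_exists\<close> every
  condition is satisfied by some point.\<close>

definition cond :: "lit set \<Rightarrow> bool" where
  "cond p \<longleftrightarrow> finite p \<and>
     (\<forall>\<sigma>. One \<sigma> \<in> p \<longrightarrow> \<sigma> \<in> T \<and> Zero \<sigma> \<notin> p \<and> (\<forall>k. One (\<sigma> @ [k]) \<notin> p)) \<and>
     (\<forall>\<sigma>. Zero \<sigma> \<in> p \<longrightarrow> \<sigma> \<in> L) \<and> (\<forall>n. In n \<in> p \<longrightarrow> Out n \<notin> p)"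

fun holds :: "(nat list \<Rightarrow> bool) \<times> nat set \<Rightarrow> lit \<Rightarrow> bool" where
  "holds z (One \<sigma>) = lab (fst z) \<sigma>"
| "holds z (Zero \<sigma>) = (\<not> lab (fst z) \<sigma>)"
| "holds z (In n) = (n \<in> snd z)"
| "holds z (Out n) = (n \<notin> snd z)"

definition sat :: "(nat list \<Rightarrow> bool) \<times> nat set \<Rightarrow> lit set \<Rightarrow> bool" where
  "sat z p \<longleftrightarrow> (\<forall>l\<in>p. holds z l)"

definition refuted :: "lit set \<Rightarrow> nat list \<Rightarrow> bool" where
  "refuted p \<sigma> \<longleftrightarrow> Zero \<sigma> \<in> p \<or> (\<exists>j. One (\<sigma> @ [j]) \<in> p)"

text \<open>Only \<open>One\<close> is subject to the bound: a \<open>Zero\<close> of a condition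
  sits at a leaf, which has rank 0, and \<open>In\<close>, \<open>Out\<close> do not concern the
  tree.\<close>

definition trunc :: "nat rel \<Rightarrow> lit set \<Rightarrow> lit set" where
  "trunc t p = {l \<in> p. \<forall>\<sigma>. l = One \<sigma> \<longrightarrow> rk \<sigma> \<le>o t}"

text \<open>For \<open>s < t\<close>, a limit node of rank above \<open>t\<close> can have children of rank \<open>\<le> s\<close>. Without the
  refutations demanded here, the truncation at \<open>t\<close> would not prevent an extension from labelling
  such a child \<open>1\<close>, against a forgotten label \<open>1\<close> of its parent.\<close>

definition good :: "nat rel \<Rightarrow> lit set \<Rightarrow> bool" where
  "good t p \<longleftrightarrow> (\<forall>\<sigma> k. One \<sigma> \<in> p \<longrightarrow> t <o rk \<sigma> \<longrightarrow> \<sigma> @ [k] \<in> T \<longrightarrow> rk (\<sigma> @ [k]) <o t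
     \<longrightarrow> refuted p (\<sigma> @ [k]))"

section \<open>Consistency and amalgamation of conditions\<close>

lemma lab_child:
  assumes "lab x \<sigma>" "\<sigma> @ [k] \<in> T"
  shows "\<not> lab x (\<sigma> @ [k])"
proof -
  have "\<sigma> \<in> T" "\<sigma> \<notin> L" using assms(2) tree_prefix unfolding leaves_def by blast+
  then show ?thesis using lab_inner assms(1) by blast
qed

text \<open>No point satisfies two clashing literals, so a point satisfying \<open>p\<close>
  certifies its consistency.\<close>

lemma cond_if_sat:
  assumes "finite p" "sat z p" "\<And>\<sigma>. One \<sigma> \<in> p \<Longrightarrow> \<sigma> \<in> T" "\<And>\<sigma>. Zero \<sigma> \<in> p \<Longrightarrow> \<sigma> \<in> L"
  shows "cond p"
  unfolding cond_def
proof (intro conjI allI impI)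
  fix \<sigma> k assume a: "One \<sigma> \<in> p"
  then show "\<sigma> \<in> T" by (rule assms(3))
  have 1: "lab (fst z) \<sigma>" using a assms(2) unfolding sat_def by force
  then show "Zero \<sigma> \<notin> p" using assms(2) unfolding sat_def by force
  show "One (\<sigma> @ [k]) \<notin> p"
  proof
    assume b: "One (\<sigma> @ [k]) \<in> p"
    then have "lab (fst z) (\<sigma> @ [k])" using assms(2) unfolding sat_def by force
    then show False using lab_child[OF 1 assms(3)[OF b]] by blast
  qed
next
  fix n assume "In n \<in> p"
  then have "n \<in> snd z" using assms(2) unfolding sat_def by force
  then show "Out n \<notin> p" using assms(2) unfolding sat_def by force
qed (use assms in auto)

lemma cond_Un_sat:
  assumes "cond p" "cond q" "sat z p" "sat z q"
  shows "cond (p \<union> q)"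
  using assms by (intro cond_if_sat[of _ z]) (auto simp: cond_def sat_def)

lemma refuted_sat:
  assumes "cond p" "sat z p" "refuted p \<sigma>"
  shows "\<not> lab (fst z) \<sigma>"
proof (cases "Zero \<sigma> \<in> p")
  case False
  then obtain j where j: "One (\<sigma> @ [j]) \<in> p" using assms(3) unfolding refuted_def by blast
  then have "lab (fst z) (\<sigma> @ [j])" using assms(2) unfolding sat_def by force
  then show ?thesis using lab_child j assms(1) unfolding cond_def by blast
qed (use assms(2) in \<open>force simp: sat_def\<close>)

lemma cond_subset: "cond p \<Longrightarrow> q \<subseteq> p \<Longrightarrow> cond q"
  unfolding cond_def by (meson finite_subset subsetD)

lemma trunc_subset: "trunc t p \<subseteq> p"
  by (auto simp: trunc_def)

lemma cond_trunc: "cond p \<Longrightarrow> cond (trunc t p)"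
  using cond_subset trunc_subset by blast

lemma refuted_mono: "refuted p \<sigma> \<Longrightarrow> p \<subseteq> q \<Longrightarrow> refuted q \<sigma>"
  by (auto simp: refuted_def)

text \<open>All of \<open>p\<close> except \<open>One\<close> at ranks above \<open>t\<close>
  already lies in the condition \<open>q\<close>. Such a forgotten \<open>One\<close> can only clash
  with \<open>One\<close> at a child of rank at most \<open>s\<close>, and there \<open>good\<close>
  supplies a refutation in \<open>p\<close> which \<open>q\<close> contains as well.\<close>

lemma cond_Un_trunc:
  assumes p: "cond p" "good t p" and q: "cond q" "trunc t p \<subseteq> q" and st: "s <o t"
  shows "cond (p \<union> trunc s q)"
proof -
  have wt: "Well_order t" using st unfolding ordLess_def by auto
  have low: "One \<sigma> \<in> q" if "One \<sigma> \<in> p" "rk \<sigma> \<le>o t" for \<sigma>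
    using that q(2) by (auto simp: trunc_def)
  have zero: "Zero \<sigma> \<in> q" if "Zero \<sigma> \<in> p" for \<sigma>
    using that q(2) by (auto simp: trunc_def)
  have io: "In n \<in> q" if "In n \<in> p" for n
    using that q(2) by (auto simp: trunc_def)
  have oi: "Out n \<in> q" if "Out n \<in> p" for n
    using that q(2) by (auto simp: trunc_def)
  have 1: "Zero \<sigma> \<notin> q" if "One \<sigma> \<in> p" for \<sigma>
  proof
    assume z: "Zero \<sigma> \<in> q"
    then have "\<sigma> \<in> L" using q(1) unfolding cond_def by blast
    then have "rk \<sigma> = {}" using leaf_iff_rk p(1) that unfolding cond_def by blast
    then have "rk \<sigma> \<le>o t" using empty_ordLeq[OF wt] by simp
    then show False using low[OF that] q(1) z unfolding cond_def by blast
  qed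
  have 2: "One (\<sigma> @ [k]) \<notin> trunc s q" if "One \<sigma> \<in> p" for \<sigma> k
  proof
    assume a: "One (\<sigma> @ [k]) \<in> trunc s q"
    then have b: "One (\<sigma> @ [k]) \<in> q" "rk (\<sigma> @ [k]) \<le>o s" by (auto simp: trunc_def)
    \<comment> \<open>Were the rank of \<open>\<sigma>\<close> at most \<open>t\<close>, then
      \<open>q\<close> would contain \<open>One\<close> at both \<open>\<sigma>\<close> and its
      child.\<close>
    have c: "\<not> rk \<sigma> \<le>o t" using low[OF that] b(1) q(1) unfolding cond_def by blast
    then have "t <o rk \<sigma>" using not_ordLeq_iff_ordLess[OF wt Well_order_rk] by blast
    moreover have d: "\<sigma> @ [k] \<in> T" using b(1) q(1) unfolding cond_def by blast
    moreover have e: "rk (\<sigma> @ [k]) <o t" using b(2) st ordLeq_ordLess_trans by blast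
    ultimately have "refuted p (\<sigma> @ [k])" using p(2) that unfolding good_def by blast
    then consider "Zero (\<sigma> @ [k]) \<in> p" | j where "One (\<sigma> @ [k] @ [j]) \<in> p"
      unfolding refuted_def by auto
    then show False
    proof cases
      case 1
      then show ?thesis using zero b(1) q(1) unfolding cond_def by blast
    next
      case (2 j)
      \<comment> \<open>The refuting grandchild has rank below \<open>t\<close>, so its
        \<open>One\<close> survives the truncation of \<open>p\<close>.\<close>
      then have "(\<sigma> @ [k]) @ [j] \<in> T" using p(1) unfolding cond_def by auto
      then have "rk ((\<sigma> @ [k]) @ [j]) \<le>o t"
        using rk_child e ordLess_transitive ordLess_imp_ordLeq by blast
      then have "One ((\<sigma> @ [k]) @ [j]) \<in> q" using low 2 by simp
      then show ?thesis using b(1) q(1) unfolding cond_def by blast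
    qed
  qed
  have 3: "One (\<sigma> @ [k]) \<notin> p" if "One \<sigma> \<in> trunc s q" for \<sigma> k
  proof
    assume a: "One (\<sigma> @ [k]) \<in> p"
    have b: "One \<sigma> \<in> q" "rk \<sigma> \<le>o s" using that by (auto simp: trunc_def)
    have "\<sigma> @ [k] \<in> T" using a p(1) unfolding cond_def by blast
    then have "rk (\<sigma> @ [k]) \<le>o t"
      using rk_child b(2) st ordLess_imp_ordLeq ordLess_ordLeq_trans ordLess_transitive by blast
    then show False using low[OF a] b(1) q(1) unfolding cond_def by blast
  qed
  have 4: "Zero \<sigma> \<notin> p" if "One \<sigma> \<in> trunc s q" for \<sigma>
    using that zero q(1) trunc_subset unfolding cond_def by blast
  have q': "cond (trunc s q)" by (rule cond_trunc[OF q(1)])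
  have 5: "In n \<in> p \<Longrightarrow> Out n \<notin> trunc s q" "Out n \<in> p \<Longrightarrow> In n \<notin> trunc s q" for n
    using io oi q(1) trunc_subset[of s q] unfolding cond_def by blast+
  have 6: "Zero \<sigma> \<notin> trunc s q" if "One \<sigma> \<in> p" for \<sigma>
    using 1[OF that] trunc_subset by blast
  show ?thesis using p(1) q' 2 3 4 5 6 unfolding cond_def by blast
qed

section \<open>Finite extensions of conditions\<close>

text \<open>The nodes are treated one by one: a leaf receives \<open>Zero\<close>, an inner node
  receives \<open>One\<close> at a fresh child. The upper bound on \<open>q\<close> lets later
  arguments control which literals are new.\<close>

lemma extend_refuted:
  assumes "finite N" "cond p" "N \<subseteq> T" "\<And>\<tau>. \<tau> \<in> N \<Longrightarrow> One \<tau> \<notin> p"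
  shows "\<exists>q. cond q \<and> p \<subseteq> q \<and> q \<subseteq> p \<union> {Zero \<tau> |\<tau>. \<tau> \<in> N} \<union> {One (\<tau> @ [j]) |\<tau> j. \<tau> \<in> N} \<and>
    (\<forall>\<tau>\<in>N. refuted q \<tau>)"
proof -
  \<comment> \<open>The last conjunct ranges over all of \<open>N\<close>, so that a new
    \<open>One\<close> never lands on a node still to be refuted.\<close>
  have "\<exists>q. cond q \<and> p \<subseteq> q \<and> q \<subseteq> p \<union> {Zero \<tau> |\<tau>. \<tau> \<in> M} \<union> {One (\<tau> @ [j]) |\<tau> j. \<tau> \<in> M} \<and>
    (\<forall>\<tau>\<in>M. refuted q \<tau>) \<and> (\<forall>\<tau>\<in>N. One \<tau> \<notin> q)" if "finite M" "M \<subseteq> N" for M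
    using that
  proof (induction M rule: finite_induct)
    case empty
    then show ?case using assms(2,4) by blast
  next
    case (insert \<tau> M)
    then obtain q where q: "cond q" "p \<subseteq> q"
      "q \<subseteq> p \<union> {Zero \<tau> |\<tau>. \<tau> \<in> M} \<union> {One (\<tau> @ [j]) |\<tau> j. \<tau> \<in> M}"
      "\<forall>\<tau>\<in>M. refuted q \<tau>" "\<forall>\<tau>\<in>N. One \<tau> \<notin> q" by auto
    have \<tau>: "\<tau> \<in> T" "One \<tau> \<notin> q" "\<tau> \<in> N" using insert.prems assms(3) q(5) by auto
    show ?case
    proof (cases "\<tau> \<in> L")
      case True
      have "cond (insert (Zero \<tau>) q)" using q(1) \<tau> True unfolding cond_def by auto
      moreover have "\<forall>\<tau>'\<in>insert \<tau> M. refuted (insert (Zero \<tau>) q) \<tau>'"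
        using q(4) unfolding refuted_def by blast
      ultimately show ?thesis using q(2,3,5) by (intro exI[of _ "insert (Zero \<tau>) q"]) auto
    next
      case False
      \<comment> \<open>\<open>j\<close> will differ from the entry at position
        \<open>length \<tau>\<close> of every node in \<open>?B\<close>; hence neither the new child
        nor any child of it is mentioned in \<open>q\<close>, and the new child is outside
        \<open>N\<close>.\<close>
      let ?B = "N \<union> {\<sigma>. Zero \<sigma> \<in> q \<or> One \<sigma> \<in> q}"
      have "{\<sigma>. Zero \<sigma> \<in> q \<or> One \<sigma> \<in> q} = Zero -` q \<union> One -` q" by auto
      then have "finite ?B"
        using q(1) assms(1) unfolding cond_def by (auto intro!: finite_vimageI simp: inj_on_def)
      then have "finite ((\<lambda>\<sigma>. \<sigma> ! length \<tau>) ` ?B)" by blast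
      then obtain j where j: "j \<notin> (\<lambda>\<sigma>. \<sigma> ! length \<tau>) ` ?B" using ex_new_if_finite infinite_UNIV_nat by blast
      have f: "\<tau> @ [j] \<notin> ?B" using j by force
      have f2: "One ((\<tau> @ [j]) @ [i]) \<notin> q" for i
      proof
        assume "One ((\<tau> @ [j]) @ [i]) \<in> q"
        then have "((\<tau> @ [j]) @ [i]) ! length \<tau> \<in> (\<lambda>\<sigma>. \<sigma> ! length \<tau>) ` ?B" by blast
        then show False using j by (simp add: nth_append)
      qed
      let ?q = "insert (One (\<tau> @ [j])) q"
      have "cond ?q"
        using q(1) f f2 \<tau>(2) children_in_tree[OF \<tau>(1) False] unfolding cond_def by auto
      moreover have "\<forall>\<tau>'\<in>insert \<tau> M. refuted ?q \<tau>'"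
        using q(4) unfolding refuted_def by blast
      moreover have "\<forall>\<tau>\<in>N. One \<tau> \<notin> ?q" using q(5) f by auto
      moreover have "?q \<subseteq> p \<union> {Zero \<tau>' |\<tau>'. \<tau>' \<in> insert \<tau> M} \<union> {One (\<tau>' @ [j]) |\<tau>' j. \<tau>' \<in> insert \<tau> M}"
        using q(3) by blast
      ultimately show ?thesis using q(2) by blast
    qed
  qed
  from this[OF assms(1) order_refl] show ?thesis by blast
qed

text \<open>By \<open>eventually_rk_child\<close> only finitely many children need a refutation.
  Refuting them adds \<open>One\<close> only at ranks below \<open>t\<close>, which creates no new
  demands.\<close>

lemma extend_good:
  assumes "cond p" "Well_order t"
  shows "\<exists>q. cond q \<and> p \<subseteq> q \<and> good t q"
proof -
  define N where "N = {\<tau>. \<exists>\<sigma> k. \<tau> = \<sigma> @ [k] \<and> One \<sigma> \<in> p \<and> t <o rk \<sigma> \<and> \<tau> \<in> T \<and> rk \<tau> <o t}"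
  have sub: "N \<subseteq> (\<Union>\<sigma>\<in>{\<sigma>. One \<sigma> \<in> p \<and> t <o rk \<sigma>}. (\<lambda>k. \<sigma> @ [k]) ` {k. rk (\<sigma> @ [k]) <o t})"
    unfolding N_def by auto
  have fin1: "finite {k. rk (\<sigma> @ [k]) <o t}" if \<sigma>: "One \<sigma> \<in> p" "t <o rk \<sigma>" for \<sigma>
  proof -
    have "\<sigma> \<in> T" using \<sigma> assms(1) unfolding cond_def by blast
    then obtain n where "\<forall>k\<ge>n. t \<le>o rk (\<sigma> @ [k])" using eventually_rk_child \<sigma>(2) by blast
    then have "{k. rk (\<sigma> @ [k]) <o t} \<subseteq> {..<n}"
      using not_ordLess_ordLeq by (metis (no_types, lifting) lessThan_iff mem_Collect_eq not_le subsetI)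
    then show ?thesis using finite_subset by blast
  qed
  have fin2: "finite {\<sigma>. One \<sigma> \<in> p \<and> t <o rk \<sigma>}"
  proof -
    have "finite (One -` p)" using assms(1) unfolding cond_def
      by (auto intro!: finite_vimageI simp: inj_on_def)
    then show ?thesis by (rule rev_finite_subset) auto
  qed
  have fin: "finite N"
    by (rule finite_subset[OF sub], rule finite_UN_I[OF fin2], rule finite_imageI, rule fin1) auto
  have NT: "N \<subseteq> T" unfolding N_def by blast
  have Np: "One \<tau> \<notin> p" if "\<tau> \<in> N" for \<tau>
    using that assms(1) unfolding N_def cond_def by blast
  obtain q where q: "cond q" "p \<subseteq> q"
    "q \<subseteq> p \<union> {Zero \<tau> |\<tau>. \<tau> \<in> N} \<union> {One (\<tau> @ [j]) |\<tau> j. \<tau> \<in> N}" "\<forall>\<tau>\<in>N. refuted q \<tau>"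
    using extend_refuted[OF fin assms(1) NT Np] by blast
  have "good t q"
    unfolding good_def
  proof (intro allI impI)
    fix \<sigma> k assume a: "One \<sigma> \<in> q" "t <o rk \<sigma>" "\<sigma> @ [k] \<in> T" "rk (\<sigma> @ [k]) <o t"
    \<comment> \<open>A newly added \<open>One\<close> sits at a child of a node of rank below
      \<open>t\<close>, contrary to the rank of \<open>\<sigma>\<close>.\<close>
    have "One \<sigma> \<in> p"
    proof (rule ccontr)
      assume "One \<sigma> \<notin> p"
      then obtain \<tau> j where \<tau>: "\<sigma> = \<tau> @ [j]" "\<tau> \<in> N" using a(1) q(3) by blast
      have "\<sigma> \<in> T" using a(1) q(1) unfolding cond_def by blast
      then have "rk \<sigma> <o rk \<tau>" using \<tau>(1) rk_child by blast
      moreover have "rk \<tau> <o t" using \<tau>(2) unfolding N_def by blast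
      ultimately show False using a(2) ordLess_transitive ordLess_irreflexive by blast
    qed
    then have "\<sigma> @ [k] \<in> N" using a unfolding N_def by blast
    then show "refuted q (\<sigma> @ [k])" using q(4) by blast
  qed
  then show ?thesis using q by blast
qed


section \<open>Forcing\<close>

definition dense :: "lit set set \<Rightarrow> bool" where
  "dense D \<longleftrightarrow> (\<forall>p. cond p \<longrightarrow> (\<exists>q\<in>D. cond q \<and> p \<subseteq> q))"

definition meets :: "(nat list \<Rightarrow> bool) \<times> nat set \<Rightarrow> lit set set \<Rightarrow> bool" where
  "meets z D \<longleftrightarrow> (\<exists>q\<in>D. cond q \<and> sat z q)"

text \<open>Forcing is defined semantically: all sufficiently generic points satisfying
  \<open>p\<close> lie in \<open>A\<close>. The conditions satisfied by \<open>z\<close> act as its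
  generic filter.\<close>

definition forces :: "lit set \<Rightarrow> ((nat list \<Rightarrow> bool) \<times> nat set) set \<Rightarrow> bool" where
  "forces p A \<longleftrightarrow> (\<exists>\<D>. countable \<D> \<and> (\<forall>D\<in>\<D>. dense D) \<and>
     (\<forall>z\<in>topspace X. sat z p \<longrightarrow> (\<forall>D\<in>\<D>. meets z D) \<longrightarrow> z \<in> A))"

section \<open>Existence of generic points\<close>

lemma dense_decide:
  assumes "\<sigma> \<in> T"
  shows "dense {q. One \<sigma> \<in> q \<or> refuted q \<sigma>}"
  unfolding dense_def
proof (intro allI impI)
  fix p assume p: "cond p"
  show "\<exists>q\<in>{q. One \<sigma> \<in> q \<or> refuted q \<sigma>}. cond q \<and> p \<subseteq> q"
    using extend_refuted[of "{\<sigma>}" p] assms p by (cases "One \<sigma> \<in> p") auto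
qed

text \<open>A Rasiowa-Sikorski argument: the union \<open>G\<close> of an increasing chain through
  the dense sets is read off as a point, and induction along the tree shows that its labels agree
  with \<open>G\<close>.\<close>

lemma generic_exists:
  assumes p: "cond p" and \<D>: "countable \<D>" "\<And>D. D \<in> \<D> \<Longrightarrow> dense D"
  shows "\<exists>z\<in>topspace X. sat z p \<and> (\<forall>D\<in>\<D>. meets z D)"
proof -
  \<comment> \<open>The added dense sets make \<open>G\<close> decide every node, so that an inner
    node without \<open>One\<close> has a child with \<open>One\<close>.\<close>
  define \<E> where "\<E> = \<D> \<union> (\<lambda>\<sigma>. {q. One \<sigma> \<in> q \<or> refuted q \<sigma>}) ` T"
  have ne: "\<E> \<noteq> {}" unfolding \<E>_def using root_in_tree by blast
  have cE: "countable \<E>" unfolding \<E>_def using \<D>(1) by simp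
  have dE: "dense D" if "D \<in> \<E>" for D
    using that \<D>(2) dense_decide unfolding \<E>_def by blast
  have dn: "dense (from_nat_into \<E> n)" for n using dE from_nat_into[OF ne] by blast
  have "\<exists>P. \<forall>n. (cond (P n) \<and> (n = 0 \<longrightarrow> P n = p)) \<and>
    (P n \<subseteq> P (Suc n) \<and> P (Suc n) \<in> from_nat_into \<E> n)"
  proof (rule dependent_nat_choice)
    show "\<exists>q. cond q \<and> ((0 :: nat) = 0 \<longrightarrow> q = p)" using p by blast
    show "\<exists>q'. (cond q' \<and> (Suc n = 0 \<longrightarrow> q' = p)) \<and> q \<subseteq> q' \<and> q' \<in> from_nat_into \<E> n"
      if "cond q \<and> (n = 0 \<longrightarrow> q = p)" for q n
      using dn[of n] that unfolding dense_def by blast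
  qed
  then obtain P where P: "\<And>n. cond (P n)" "P 0 = p" "\<And>n. P n \<subseteq> P (Suc n)"
      "\<And>n. P (Suc n) \<in> from_nat_into \<E> n"
    by auto
  have mono: "P m \<subseteq> P n" if "m \<le> n" for m n
    using P(3) that by (rule lift_Suc_mono_le)
  define G where "G = (\<Union>n. P n)"
  have PG: "P n \<subseteq> G" for n unfolding G_def by blast
  \<comment> \<open>Each consistency clause involves at most two literals, so it passes from the
    members of the chain to \<open>G\<close>.\<close>
  have two: "\<exists>n. a \<in> P n \<and> b \<in> P n" if ab: "a \<in> G" "b \<in> G" for a b
  proof -
    obtain m n where "a \<in> P m" "b \<in> P n" using ab unfolding G_def by blast
    then show ?thesis using mono[of m "max m n"] mono[of n "max m n"] by auto
  qed
  have G1: "\<sigma> \<in> T" "Zero \<sigma> \<notin> G" "One (\<sigma> @ [k]) \<notin> G" if "One \<sigma> \<in> G" for \<sigma> k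
    using two[OF that] two[OF that that] P(1) that unfolding cond_def by blast+
  have G2: "Out n \<notin> G" if "In n \<in> G" for n
    using two[OF that] P(1) unfolding cond_def by blast
  have G3: "\<sigma> \<in> L" if "Zero \<sigma> \<in> G" for \<sigma>
    using two[OF that that] P(1) unfolding cond_def by blast
  have PE: "\<exists>n. P n \<in> D" if "D \<in> \<E>" for D
    using from_nat_into_surj[OF cE that] P(4) by blast
  have G4: "One \<sigma> \<in> G \<or> refuted G \<sigma>" if "\<sigma> \<in> T" for \<sigma>
    using PE[of "{q. One \<sigma> \<in> q \<or> refuted q \<sigma>}"] that PG refuted_mono unfolding \<E>_def by blast
  define x where "x = restrict (\<lambda>\<sigma>. One \<sigma> \<in> G) L"
  have lab: "lab x \<sigma> \<longleftrightarrow> One \<sigma> \<in> G" if "\<sigma> \<in> T" for \<sigma>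
    using wf_child_rel[OF wo fund] that
  proof (induction \<sigma> rule: wf_induct_rule)
    case (less \<sigma>)
    show ?case
    proof (cases "\<sigma> \<in> L")
      case True
      then show ?thesis by (simp add: lab_leaf x_def)
    next
      case False
      have IH: "lab x (\<sigma> @ [k]) \<longleftrightarrow> One (\<sigma> @ [k]) \<in> G" for k
        using less.IH children_in_tree[OF less.prems False] unfolding child_rel_def by blast
      have "Zero \<sigma> \<notin> G" using G3 False by blast
      then have "One \<sigma> \<in> G \<longleftrightarrow> (\<forall>k. One (\<sigma> @ [k]) \<notin> G)"
        using G1 G4[OF less.prems] unfolding refuted_def by blast
      then show ?thesis using lab_inner[OF less.prems False, of x] IH by blast
    qed
  qed
  define z where "z = (x, {n. In n \<in> G})"
  have "holds z l" if "l \<in> G" for l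
  proof (cases l)
    case (One \<sigma>)
    then show ?thesis using lab G1 that by (simp add: z_def)
  next
    case (Zero \<sigma>)
    moreover have "\<sigma> \<in> T" using Zero G3 that unfolding leaves_def by blast
    ultimately show ?thesis using lab G1 that by (auto simp: z_def)
  qed (use that G2 in \<open>auto simp: z_def\<close>)
  then have satP: "sat z (P n)" for n using PG unfolding sat_def by blast
  have "z \<in> topspace X" unfolding z_def x_def by (simp add: topspace_X)
  moreover have "meets z D" if "D \<in> \<D>" for D
    using PE[of D] that satP P(1) unfolding \<E>_def meets_def by blast
  ultimately show ?thesis using satP[of 0] P(2) by blast
qed

section \<open>Closure properties of forcing\<close>

lemma forces_mono: "forces p A \<Longrightarrow> p \<subseteq> q \<Longrightarrow> A \<inter> topspace X \<subseteq> B \<Longrightarrow> forces q B"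
  unfolding forces_def sat_def by (smt (verit, ccfv_threshold) IntI subsetD)

lemma forces_INT:
  assumes "countable I" "\<And>i. i \<in> I \<Longrightarrow> forces p (A i)"
  shows "forces p (\<Inter>i\<in>I. A i)"
proof -
  obtain \<D> where \<D>: "\<And>i. i \<in> I \<Longrightarrow> countable (\<D> i) \<and> (\<forall>D\<in>\<D> i. dense D) \<and>
     (\<forall>z\<in>topspace X. sat z p \<longrightarrow> (\<forall>D\<in>\<D> i. meets z D) \<longrightarrow> z \<in> A i)"
    using assms(2) unfolding forces_def by metis
  then show ?thesis
    unfolding forces_def using assms(1) by (intro exI[of _ "\<Union>i\<in>I. \<D> i"]) auto
qed

lemma forces_Int: "forces p A \<Longrightarrow> forces p B \<Longrightarrow> forces p (A \<inter> B)"
  using forces_INT[of "UNIV :: bool set" p "\<lambda>b. if b then A else B"] by (simp add: UNIV_bool Int_commute)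

lemma forces_nonempty:
  assumes "cond p" "forces p A"
  shows "\<exists>z\<in>topspace X. sat z p \<and> z \<in> A"
proof -
  obtain \<D> where \<D>: "countable \<D>" "\<And>D. D \<in> \<D> \<Longrightarrow> dense D"
     "\<And>z. z\<in>topspace X \<Longrightarrow> sat z p \<Longrightarrow> (\<forall>D\<in>\<D>. meets z D) \<Longrightarrow> z \<in> A"
    using assms(2) unfolding forces_def by metis
  then show ?thesis using generic_exists[OF assms(1) \<D>(1,2)] by blast
qed

text \<open>There are only countably many conditions, so the dense sets witnessing that each of them
  forces \<open>A\<close> can be merged into one countable family; one further dense set
  \<open>E\<close> makes generic points satisfy such a condition.\<close>

lemma forces_densely:
  assumes p: "cond p" and dens: "\<And>q. cond q \<Longrightarrow> p \<subseteq> q \<Longrightarrow> \<exists>q'. cond q' \<and> q \<subseteq> q' \<and> forces q' A"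
  shows "forces p A"
proof -
  define F where "F = {q. cond q \<and> forces q A}"
  have "F \<subseteq> {q. finite q}" unfolding F_def cond_def by blast
  then have cF: "countable F" using countable_Collect_finite countable_subset by blast
  define W where "W q \<D> \<longleftrightarrow> countable \<D> \<and> (\<forall>D\<in>\<D>. dense D) \<and>
    (\<forall>z\<in>topspace X. sat z q \<longrightarrow> (\<forall>D\<in>\<D>. meets z D) \<longrightarrow> z \<in> A)" for q \<D>
  have "\<forall>q\<in>F. \<exists>\<D>. W q \<D>" unfolding F_def forces_def W_def by blast
  then obtain \<D> where W: "\<forall>q\<in>F. W q (\<D> q)" by (auto dest: bchoice)
  then have \<D>: "countable (\<D> q)" "\<forall>D\<in>\<D> q. dense D"
    "\<And>z. z \<in> topspace X \<Longrightarrow> sat z q \<Longrightarrow> \<forall>D\<in>\<D> q. meets z D \<Longrightarrow> z \<in> A" if "q \<in> F" for q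
    using that unfolding W_def by blast+
  \<comment> \<open>Conditions incompatible with \<open>p\<close> are included for density; a point
    satisfying \<open>p\<close> satisfies none of them.\<close>
  define E where "E = F \<union> {q. \<not> cond (p \<union> q)}"
  have "dense E"
    unfolding dense_def
  proof (intro allI impI)
    fix q assume q: "cond q"
    show "\<exists>q'\<in>E. cond q' \<and> q \<subseteq> q'"
    proof (cases "cond (p \<union> q)")
      case True
      then show ?thesis using dens[OF True] unfolding E_def F_def by blast
    qed (use q in \<open>auto simp: E_def\<close>)
  qed
  moreover have "z \<in> A" if z: "z \<in> topspace X" "sat z p" "meets z E" "\<forall>q\<in>F. \<forall>D\<in>\<D> q. meets z D" for z
  proof -
    obtain q where q: "q \<in> E" "cond q" "sat z q" using z(3) unfolding meets_def by blast
    then have "q \<in> F" using cond_Un_sat[OF p q(2) z(2) q(3)] unfolding E_def by blast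
    then show ?thesis using \<D>(3) z(1,4) q(3) by blast
  qed
  ultimately show ?thesis
    unfolding forces_def using cF \<D>(1,2) by (intro exI[of _ "insert E (\<Union>q\<in>F. \<D> q)"]) auto
qed

section \<open>Truncation along the Borel hierarchy\<close>

text \<open>The invariant of the induction over the hierarchy. The strict bound on \<open>t\<close>
  reflects that a set at level \<open>s > 1\<close> is a union of complements of sets of lower
  levels.\<close>

definition decided_below :: "nat rel \<Rightarrow> ((nat list \<Rightarrow> bool) \<times> nat set) set \<Rightarrow> bool" where
  "decided_below s A \<longleftrightarrow> (\<forall>p. cond p \<longrightarrow> forces p (topspace X - A) \<or>
     (\<exists>q t. cond q \<and> p \<subseteq> q \<and> t <o s \<and> good t q \<and> forces (trunc t q) A))"

text \<open>Otherwise some extension of the truncation would have a truncation at a level below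
  \<open>s\<close> forcing \<open>B\<close>. By \<open>cond_Un_trunc\<close> this is compatible with
  \<open>p\<close>, and the union would force both \<open>B\<close> and its complement.\<close>

lemma forces_trunc:
  assumes B: "decided_below s B" and p: "cond p" "good s p" "forces p (topspace X - B)"
  shows "forces (trunc s p) (topspace X - B)"
proof (rule forces_densely[OF cond_trunc[OF p(1)]])
  fix q assume q: "cond q" "trunc s p \<subseteq> q"
  have "forces q (topspace X - B)"
  proof (rule ccontr)
    assume "\<not> ?thesis"
    then obtain q' t where q': "cond q'" "q \<subseteq> q'" "t <o s" "forces (trunc t q') B"
      using B q(1) unfolding decided_below_def by blast
    have c: "cond (p \<union> trunc t q')"
      using cond_Un_trunc[OF p(1,2) q'(1) _ q'(3)] q(2) q'(2) by blast
    have "forces (p \<union> trunc t q') ((topspace X - B) \<inter> B)"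
      using forces_Int forces_mono[OF p(3)] forces_mono[OF q'(4)] by (meson Int_lower1 Un_upper1 Un_upper2)
    then show False using forces_nonempty[OF c] by blast
  qed
  then show "\<exists>q'. cond q' \<and> q \<subseteq> q' \<and> forces q' (topspace X - B)" using q(1) by blast
qed

text \<open>Truncation at rank 0 suffices: a basic neighbourhood is described by literals at leaves
  and numbers, all of which survive it.\<close>

lemma decided_below_open:
  assumes s: "Well_order s" "Field s \<noteq> {}" and A: "openin X A"
  shows "decided_below s A"
  unfolding decided_below_def
proof (intro allI impI disjCI)
  fix p assume p: "cond p" and "\<not> (\<exists>q t. cond q \<and> p \<subseteq> q \<and> t <o s \<and> good t q \<and> forces (trunc t q) A)"
  moreover have "{} <o s" by (rule empty_ordLess[OF s])
  \<comment> \<open>No node has rank below 0, so goodness is vacuous.\<close>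
  moreover have "good {} q" for q
  proof -
    have "\<not> rk \<sigma> <o ({} :: nat rel)" for \<sigma>
      using empty_ordLeq[OF Well_order_rk] not_ordLess_ordLeq by blast
    then show ?thesis unfolding good_def by blast
  qed
  ultimately have no: "\<not> forces (trunc {} q) A" if "cond q" "p \<subseteq> q" for q
    using that by blast
  have "z \<notin> A" if z: "z \<in> topspace X" "sat z p" for z
  proof
    assume zA: "z \<in> A"
    obtain x y where xy: "z = (x, y)" by (cases z)
    obtain F G where FG: "F \<subseteq> L" "finite F" "finite G"
      "\<And>x' y'. (x', y') \<in> topspace X \<Longrightarrow> \<forall>\<sigma>\<in>F. x' \<sigma> = x \<sigma> \<Longrightarrow> \<forall>n\<in>G. n \<in> y' \<longleftrightarrow> n \<in> y \<Longrightarrow> (x', y') \<in> A"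
      using openin_X_nbhd[OF A] zA xy by metis
    \<comment> \<open>\<open>Q\<close> describes the neighbourhood of \<open>z\<close> given by
      \<open>F\<close> and \<open>G\<close>; it is compatible with \<open>p\<close> because
      \<open>z\<close> satisfies both.\<close>
    define Q where "Q = One ` {\<sigma> \<in> F. x \<sigma>} \<union> Zero ` {\<sigma> \<in> F. \<not> x \<sigma>} \<union> In ` (G \<inter> y) \<union> Out ` (G - y)"
    have "F \<subseteq> T" using FG(1) unfolding leaves_def by blast
    have satQ: "sat z Q" using FG(1) lab_leaf unfolding sat_def Q_def xy by auto
    have "cond (p \<union> Q)"
    proof (rule cond_if_sat)
      show "finite (p \<union> Q)" using p FG(2,3) unfolding cond_def Q_def by simp
      show "sat z (p \<union> Q)" using z(2) satQ unfolding sat_def by blast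
    qed (use p FG(1) \<open>F \<subseteq> T\<close> in \<open>auto simp: Q_def cond_def\<close>)
    moreover have "forces (trunc {} (p \<union> Q)) A"
    proof -
      have "Q \<subseteq> trunc {} (p \<union> Q)"
      proof
        fix l assume l: "l \<in> Q"
        have "rk \<sigma> \<le>o ({} :: nat rel)" if "l = One \<sigma>" for \<sigma>
        proof -
          have "\<sigma> \<in> L" using l that FG(1) unfolding Q_def by auto
          then have "rk \<sigma> = {}" using leaf_iff_rk unfolding leaves_def by blast
          moreover have "({} :: nat rel) \<le>o rk \<sigma>" by (rule empty_ordLeq[OF Well_order_rk])
          ultimately show ?thesis by simp
        qed
        then show "l \<in> trunc {} (p \<union> Q)" using l unfolding trunc_def by blast
      qed
      moreover have "z' \<in> A" if z': "z' \<in> topspace X" "sat z' Q" for z'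
      proof -
        obtain x' y' where xy': "z' = (x', y')" by (cases z')
        have "x' \<sigma> = x \<sigma>" if "\<sigma> \<in> F" for \<sigma>
        proof -
          have "x' \<sigma> = lab x' \<sigma>" using lab_leaf that FG(1) by auto
          also have "\<dots> = x \<sigma>" using z'(2) that unfolding sat_def Q_def xy' by (cases "x \<sigma>") force+
          finally show ?thesis .
        qed
        moreover have "n \<in> y' \<longleftrightarrow> n \<in> y" if "n \<in> G" for n
          using z'(2) that unfolding sat_def Q_def xy' by (cases "n \<in> y") force+
        ultimately show ?thesis using FG(4) z'(1) xy' by simp
      qed
      ultimately show ?thesis
        unfolding forces_def sat_def by (intro exI[of _ "{}"]) blast
    qed
    ultimately show False using no by blast
  qed
  then show "forces p (topspace X - A)"
    unfolding forces_def by (intro exI[of _ "{}"]) auto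
qed

text \<open>If an extension of \<open>p\<close> forces the complement of some \<open>B n\<close>, it
  is made good and truncated at the level of \<open>B n\<close>. Otherwise every \<open>B n\<close>
  is forced densely below \<open>p\<close>, so \<open>p\<close> forces their intersection, the
  complement of the union.\<close>

lemma Sigma0_decided_below:
  assumes "Sigma0 X s A"
  shows "decided_below s A"
  using assms
proof (induction rule: Sigma0.induct)
  case (open_set s A)
  then have "Field s \<noteq> {}" by auto
  then show ?case using decided_below_open open_set by blast
next
  case (union s r' B)
  have dB: "decided_below (s n) (B n)" and sl: "s n <o r'" for n
    using union by auto
  have ws: "Well_order (s n)" for n using sl[of n] unfolding ordLess_def by auto
  let ?A = "\<Union>n. topspace X - B n"
  show ?case
    unfolding decided_below_def
  proof (intro allI impI)
    fix p assume p: "cond p"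
    show "forces p (topspace X - ?A) \<or>
      (\<exists>q t. cond q \<and> p \<subseteq> q \<and> t <o r' \<and> good t q \<and> forces (trunc t q) ?A)"
    proof (cases "\<exists>n q. cond q \<and> p \<subseteq> q \<and> forces q (topspace X - B n)")
      case True
      then obtain n q where q: "cond q" "p \<subseteq> q" "forces q (topspace X - B n)" by blast
      obtain q' where q': "cond q'" "q \<subseteq> q'" "good (s n) q'"
        using extend_good[OF q(1) ws[of n]] by blast
      have "forces q' (topspace X - B n)" using forces_mono[OF q(3) q'(2)] by blast
      from forces_trunc[OF dB q'(1,3) this]
      have "forces (trunc (s n) q') ?A" by (rule forces_mono) auto
      then show ?thesis using q' q(2) sl by blast
    next
      case False
      have "forces p (B n)" for n
      proof (rule forces_densely[OF p])
        fix q assume q: "cond q" "p \<subseteq> q"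
        then obtain q' t where q': "cond q'" "q \<subseteq> q'" "forces (trunc t q') (B n)"
          using dB[of n] False unfolding decided_below_def by blast
        then have "forces q' (B n)" using forces_mono[OF q'(3) trunc_subset] by blast
        then show "\<exists>q'. cond q' \<and> q \<subseteq> q' \<and> forces q' (B n)" using q' by blast
      qed
      then have "forces p (\<Inter>n. B n)" by (intro forces_INT) auto
      then have "forces p (topspace X - ?A)" by (rule forces_mono) auto
      then show ?thesis ..
    qed
  qed
qed


section \<open>Colours contain edges\<close>

fun flip_lit :: "nat \<Rightarrow> lit \<Rightarrow> lit" where
  "flip_lit n (In m) = (if m = n then Out m else In m)"
| "flip_lit n (Out m) = (if m = n then In m else Out m)"
| "flip_lit n l = l"

text \<open>Together with \<open>flip_lit\<close> this is an automorphism of the forcing, an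
  involution that moves a point along the potential edge with label \<open>n\<close>.\<close>

definition flip :: "nat \<Rightarrow> (nat list \<Rightarrow> bool) \<times> nat set \<Rightarrow> (nat list \<Rightarrow> bool) \<times> nat set" where
  "flip n z = (fst z, sym_diff (snd z) {n})"

lemma flip_lit_flip_lit: "flip_lit n (flip_lit n l) = l"
  by (cases l) auto

lemma mem_flip_image: "l \<in> flip_lit n ` p \<longleftrightarrow> flip_lit n l \<in> p"
  by (metis (no_types) flip_lit_flip_lit image_iff)

lemma cond_flip: "cond p \<Longrightarrow> cond (flip_lit n ` p)"
  unfolding cond_def mem_flip_image by auto

lemma sat_flip: "sat (flip n z) (flip_lit n ` p) \<longleftrightarrow> sat z p"
proof -
  have "holds (flip n z) (flip_lit n l) \<longleftrightarrow> holds z l" for l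
    by (cases l) (auto simp: flip_def)
  then show ?thesis unfolding sat_def by simp
qed

lemma flip_flip: "flip n (flip n z) = z"
  by (cases z) (auto simp: flip_def)

lemma topspace_flip: "flip n z \<in> topspace X \<longleftrightarrow> z \<in> topspace X"
  by (cases z) (simp add: flip_def topspace_X)

lemma dense_flip:
  assumes "dense D"
  shows "dense ((`) (flip_lit n) ` D)"
  unfolding dense_def
proof (intro allI impI)
  fix p assume "cond p"
  then obtain q where q: "q \<in> D" "cond q" "flip_lit n ` p \<subseteq> q"
    using assms cond_flip unfolding dense_def by blast
  have "flip_lit n ` flip_lit n ` p = p" by (simp add: image_image flip_lit_flip_lit)
  then have "p \<subseteq> flip_lit n ` q" using q(3) by blast
  then show "\<exists>q\<in>(`) (flip_lit n) ` D. cond q \<and> p \<subseteq> q" using q(1) cond_flip[OF q(2)] by blast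
qed

text \<open>A condition silent about \<open>n\<close> is fixed by the automorphism, so it suffices
  to move the witnessing dense sets along it.\<close>

lemma forces_flip:
  assumes "forces p A" "In n \<notin> p" "Out n \<notin> p"
  shows "forces p {z. flip n z \<in> A}"
proof -
  obtain \<D> where \<D>: "countable \<D>" "\<And>D. D \<in> \<D> \<Longrightarrow> dense D"
     "\<And>z. z\<in>topspace X \<Longrightarrow> sat z p \<Longrightarrow> (\<forall>D\<in>\<D>. meets z D) \<Longrightarrow> z \<in> A"
    using assms(1) unfolding forces_def by metis
  have "flip_lit n l = l" if "l \<in> p" for l
    using assms(2,3) that by (cases l) auto
  then have fp: "flip_lit n ` p = p" by simp
  have "flip n z \<in> A" if z: "z \<in> topspace X" "sat z p" "\<forall>D\<in>\<D>. meets z ((`) (flip_lit n) ` D)" for z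
  proof (rule \<D>(3))
    show "flip n z \<in> topspace X" using z(1) topspace_flip by blast
    show "sat (flip n z) p" using z(2) sat_flip[of n z p] fp by simp
    show "\<forall>D\<in>\<D>. meets (flip n z) D"
    proof
      fix D assume "D \<in> \<D>"
      then obtain q where q: "q \<in> D" "cond (flip_lit n ` q)" "sat z (flip_lit n ` q)"
        using z(3) unfolding meets_def by blast
      have "cond q" using cond_flip[OF q(2), of n] by (simp add: image_image flip_lit_flip_lit)
      moreover have "sat (flip n z) q" using q(3) sat_flip[of n "flip n z" q] by (simp add: flip_flip)
      ultimately show "meets (flip n z) D" using q(1) unfolding meets_def by blast
    qed
  qed
  then show ?thesis
    unfolding forces_def using \<D>(1) dense_flip[OF \<D>(2)]
    by (intro exI[of _ "(\<lambda>D. (`) (flip_lit n) ` D) ` \<D>"]) auto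
qed

text \<open>Since \<open>t\<close> is below the rank of the root, the truncation forgets
  \<open>One []\<close>, and the fresh child may receive label 1. Refuting all earlier children
  makes it the least such child, which determines the edge.\<close>

lemma edge_in_forced:
  assumes q: "cond q" "One [] \<in> q" and t: "t <o r" "good t q" and A: "forces (trunc t q) A"
  shows "\<exists>(u, v)\<in>K_graph r fs. u \<in> A \<and> v \<in> A"
proof -
  have root: "[] \<notin> L"
    using leaf_iff_rk[OF root_in_tree] rk_root field_nonempty by auto
  have child: "[k] \<in> T" for k using children_in_tree[OF root_in_tree root, of k] by simp
  have "\<not> r \<le>o t" using t(1) not_ordLess_ordLeq by blast
  then have p0: "One [] \<notin> trunc t q" unfolding trunc_def using rk_root by auto
  \<comment> \<open>A number outside \<open>B\<close> occurs neither as first entry of a node in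
    \<open>q\<close> nor in an \<open>In\<close> or \<open>Out\<close> literal; the unspecified
    \<open>hd []\<close> merely excludes one more number.\<close>
  define B where "B = (\<lambda>l. case l of One \<sigma> \<Rightarrow> hd \<sigma> | Zero \<sigma> \<Rightarrow> hd \<sigma> | In m \<Rightarrow> m | Out m \<Rightarrow> m) ` q"
  have "finite B" using q(1) unfolding B_def cond_def by simp
  then obtain n where n: "n \<notin> B" using ex_new_if_finite infinite_UNIV_nat by blast
  have nq: "One (n # \<sigma>) \<notin> q" "Zero (n # \<sigma>) \<notin> q" "In n \<notin> q" "Out n \<notin> q" for \<sigma>
    using n unfolding B_def by (force simp: image_iff)+
  let ?p1 = "insert (One [n]) (trunc t q)"
  have ct: "cond (trunc t q)" by (rule cond_trunc[OF q(1)])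
  have t1: "l \<notin> trunc t q" if "l \<notin> q" for l using that trunc_subset by blast
  have p1: "cond ?p1"
    using ct child[of n] t1[OF nq(1)] t1[OF nq(2)] p0 unfolding cond_def by auto
  let ?N = "(\<lambda>m. [m]) ` {..<n}"
  \<comment> \<open>Although forgotten by the truncation, \<open>One []\<close> in \<open>q\<close>
    ensures that \<open>q\<close> demands label 1 at no child of the root.\<close>
  have "One \<tau> \<notin> ?p1" if \<tau>: "\<tau> \<in> ?N" for \<tau>
  proof -
    obtain m where m: "\<tau> = [] @ [m]" "m < n" using \<tau> by auto
    then show ?thesis using q t1 unfolding cond_def by force
  qed
  moreover have "finite ?N" "?N \<subseteq> T" using child by auto
  ultimately obtain p2 where p2: "cond p2" "?p1 \<subseteq> p2"
     "p2 \<subseteq> ?p1 \<union> {Zero \<tau> |\<tau>. \<tau> \<in> ?N} \<union> {One (\<tau> @ [j]) |\<tau> j. \<tau> \<in> ?N}" "\<forall>\<tau>\<in>?N. refuted p2 \<tau>"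
    using extend_refuted[OF _ p1, of ?N] by blast
  have io: "In n \<notin> p2" "Out n \<notin> p2" using p2(3) t1[OF nq(3)] t1[OF nq(4)] by auto
  \<comment> \<open>\<open>Out n\<close> directs the edge from \<open>z\<close> to its flip. It
    comes only now because \<open>forces_flip\<close> needs a condition silent about
    \<open>n\<close>.\<close>
  let ?p3 = "insert (Out n) p2"
  have p3: "cond ?p3" using p2(1) io unfolding cond_def by auto
  have fA: "forces p2 A" using forces_mono[OF A] p2(2) by blast
  have "forces ?p3 (A \<inter> {z. flip n z \<in> A})"
    by (rule forces_mono[OF forces_Int[OF fA forces_flip[OF fA io]]]) auto
  then obtain z where z: "z \<in> topspace X" "sat z ?p3" "z \<in> A" "flip n z \<in> A"
    using forces_nonempty[OF p3] by blast
  obtain x y where xy: "z = (x, y)" by (cases z)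
  have z2: "sat z p2" and ny: "n \<notin> y" using z(2) xy unfolding sat_def by auto
  have lab_n: "lab x [n]" using z2 p2(2) xy unfolding sat_def by auto
  have lab_m: "\<not> lab x [m]" if "m < n" for m
    using refuted_sat[OF p2(1) z2] p2(4) that xy by auto
  have "(LEAST m. lab x [m]) = n"
    by (rule Least_equality[where P = "\<lambda>m. lab x [m]"], rule lab_n) (use lab_m in \<open>auto simp: not_less[symmetric]\<close>)
  moreover have "\<not> lab x []" using lab_inner[OF root_in_tree root, of x] lab_n by auto
  moreover have "flip n z \<in> topspace X" using z(1) topspace_flip by blast
  ultimately have "(z, flip n z) \<in> K_graph r fs"
    using z(1) ny unfolding K_graph_def xy flip_def by (auto simp: Let_def)
  then show ?thesis using z(3,4) by blast
qed

lemma no_countable_Sigma0_colouring: "\<not> countable_Sigma0_colouring r X (K_graph r fs) P"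
proof
  assume c: "countable_Sigma0_colouring r X (K_graph r fs) P"
  have root: "cond {One []}" using root_in_tree unfolding cond_def by auto
  \<comment> \<open>If the complements of all colours were forced, some generic point would have no
    colour.\<close>
  have "\<exists>A\<in>P. \<not> forces {One []} (topspace X - A)"
  proof (rule ccontr)
    assume "\<not> ?thesis"
    then have "forces {One []} (\<Inter>A\<in>P. topspace X - A)"
      using c by (intro forces_INT) (auto simp: countable_Sigma0_colouring_def)
    then obtain z where "z \<in> topspace X" "z \<in> (\<Inter>A\<in>P. topspace X - A)"
      using forces_nonempty[OF root] by blast
    then show False using c unfolding countable_Sigma0_colouring_def partition_on_def by blast
  qed
  then obtain A where A: "A \<in> P" "\<not> forces {One []} (topspace X - A)" by blast
  have "decided_below r A"
    using Sigma0_decided_below A(1) c unfolding countable_Sigma0_colouring_def by blast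
  then obtain q t where "cond q" "{One []} \<subseteq> q" "t <o r" "good t q" "forces (trunc t q) A"
    using root A(2) unfolding decided_below_def by blast
  then have "\<exists>(u, v)\<in>K_graph r fs. u \<in> A \<and> v \<in> A" using edge_in_forced by simp
  then show False using A(1) c unfolding countable_Sigma0_colouring_def by blast
qed

end

theorem theorem3p3:
  fixes r :: "nat rel" and fs :: "nat option \<Rightarrow> nat \<Rightarrow> nat"
  assumes "computable_ordinal r" and "Field r \<noteq> {}" and "fundamental_sequences r fs"
  shows "\<nexists>P. countable_Sigma0_colouring r (X_space r fs) (K_graph r fs) P"
proof -
  interpret ranked_tree r fs
    using assms by unfold_locales (auto simp: computable_ordinal_def)
  show ?thesis using no_countable_Sigma0_colouring by blast
qed

end
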